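(* Let $(M,g)$ be a pseudo-Riemannian surface and let its unit tangent bundle $T_1M$ be endowed with a pseudo-Riemannian $g$-natural metric $\tilde G$ of Kaluza-Klein type. Then any smooth vertical curve in $T_1M$, parameterized by its arc length, is a helix curve with direction the geodesic vector field.
   Context: $T_1M=\{(x,u)\in TM: g_x(u,u)=1\}$. For $X\in T_xM$, $X^h$ and $X^v$ are the horizontal and vertical lifts of $X$ to $(x,u)$ with respect to the Levi-Civita connection $\nabla$ of $g$, and $X^t=X^v-g(X,u)u^v$ is the tangential lift; $T_{(x,u)}T_1M=\{X^h+Y^t: X,Y\in T_xM\}$. For real constants $a,c,d$ with $a(a+c)\neq0$ and $a+c+d\neq 0$, the $g$-natural metric of Kaluza-Klein type $\tilde G$ on $T_1M$ is $\tilde G_{(x,u)}(X^h,Y^h)=(a+c)g(X,Y)+d\,g(X,u)g(Y,u)$, $\tilde G_{(x,u)}(X^h,Y^t)=0$, $\tilde G_{(x,u)}(X^t,Y^t)=a\,g(X,Y)-a\,g(X,u)g(Y,u)$. The geodesic vector field on $T_1M$ is $(x,u)\mapsto u^h$. A curve $\lambda=(x,V)$ in $T_1M$ ($x$ a curve in $M$, $V$ a vector field along $x$ with $g(V,V)=1$) is vertical if $x$ is constant. A curve $\lambda$ parameterized by (pseudo-)arc length is a helix curve with direction the geodesic vector field if $\tilde G(\lambda',u^h)$ (with $u^h$ evaluated along $\lambda$) is constant along $\lambda$. *)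

theory Defs
  imports "HOL-Analysis.Analysis" "HOL-Library.Function_Algebras"
begin

instantiation "fun" :: (type, real_vector) real_vector
begin

definition scaleR_fun :: "real \<Rightarrow> ('a \<Rightarrow> 'b) \<Rightarrow> 'a \<Rightarrow> 'b"
  where "scaleR_fun r f = (\<lambda>x. r *\<^sub>R f x)"

instance
  by standard (simp_all add: scaleR_fun_def fun_eq_iff scaleR_add_right scaleR_add_left)

end

subsection \<open>Smooth maps between Euclidean spaces\<close>

text \<open>Derivatives are taken within the domain S. They are unique, as needed, for the domains used
  below: open sets, and relatively open subsets of nondegenerate real intervals.\<close>

primrec Ck_on :: "nat \<Rightarrow> 'a::real_normed_vector set \<Rightarrow> ('a \<Rightarrow> 'b::real_normed_vector) \<Rightarrow> bool"
  where
    "Ck_on 0 S f \<longleftrightarrow> continuous_on S f"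
  | "Ck_on (Suc k) S f \<longleftrightarrow> f differentiable_on S \<and>
       (\<forall>v. Ck_on k S (\<lambda>x. frechet_derivative f (at x within S) v))"

definition smooth_on :: "'a::real_normed_vector set \<Rightarrow> ('a \<Rightarrow> 'b::real_normed_vector) \<Rightarrow> bool"
  where "smooth_on S f \<longleftrightarrow> (\<forall>k. Ck_on k S f)"

subsection \<open>Smooth manifolds\<close>

text \<open>A chart is a pair of a domain and a coordinate map; values of the map off the domain are
  irrelevant.\<close>

type_synonym ('a, 'e) chart = "'a set \<times> ('a \<Rightarrow> 'e)"

definition chart_inv :: "('a, 'e) chart \<Rightarrow> 'e \<Rightarrow> 'a"
  where "chart_inv c = inv_into (fst c) (snd c)"

definition points :: "('a, 'e) chart set \<Rightarrow> 'a set"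
  where "points A = \<Union> (fst ` A)"

definition chart_at :: "('a, 'e) chart set \<Rightarrow> 'a \<Rightarrow> ('a, 'e) chart"
  where "chart_at A p = (SOME c. c \<in> A \<and> p \<in> fst c)"

definition smooth_manifold :: "'a topology \<Rightarrow> ('a, 'e::euclidean_space) chart set \<Rightarrow> bool"
  where "smooth_manifold T A \<longleftrightarrow>
    Hausdorff_space T \<and> second_countable T \<and> points A = topspace T \<and>
    (\<forall>c\<in>A. openin T (fst c) \<and> open (snd c ` fst c) \<and>
       homeomorphic_map (subtopology T (fst c)) (top_of_set (snd c ` fst c)) (snd c)) \<and>
    (\<forall>c\<in>A. \<forall>d\<in>A. smooth_on (snd c ` (fst c \<inter> fst d)) (snd d \<circ> chart_inv c))"

definition smooth_functions :: "('a, 'e::euclidean_space) chart set \<Rightarrow> ('a \<Rightarrow> real) set"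
  where "smooth_functions A = {f. \<forall>c\<in>A. smooth_on (snd c ` fst c) (f \<circ> chart_inv c)}"

text \<open>A curve is defined on a nondegenerate interval I, with or without its endpoints.\<close>

definition smooth_curve :: "('a, 'e::euclidean_space) chart set \<Rightarrow> real set \<Rightarrow> (real \<Rightarrow> 'a) \<Rightarrow> bool"
  where "smooth_curve A I \<gamma> \<longleftrightarrow> is_interval I \<and> interior I \<noteq> {} \<and>
    (\<forall>t\<in>I. \<exists>c\<in>A. \<exists>J. open J \<and> t \<in> J \<and> \<gamma> ` (I \<inter> J) \<subseteq> fst c \<and> smooth_on (I \<inter> J) (snd c \<circ> \<gamma>))"

subsection \<open>Tangent vectors\<close>

text \<open>A tangent vector at p is the family of its components in all charts around p, related by
  the derivatives of the coordinate changes. The components in the other charts are set to 0, so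
  that the vector operations are the pointwise ones.\<close>

type_synonym ('a, 'e) tvec = "('a, 'e) chart \<Rightarrow> 'e"

definition tangent_space :: "('a, 'e::euclidean_space) chart set \<Rightarrow> 'a \<Rightarrow> ('a, 'e) tvec set"
  where "tangent_space A p = {X.
    (\<forall>c\<in>A. \<forall>d\<in>A. p \<in> fst c \<longrightarrow> p \<in> fst d \<longrightarrow>
       X d = frechet_derivative (snd d \<circ> chart_inv c) (at (snd c p)) (X c)) \<and>
    (\<forall>c. \<not> (c \<in> A \<and> p \<in> fst c) \<longrightarrow> X c = 0)}"

text \<open>The tangent vector at p whose components in the chart c are v.\<close>

definition coord_vector ::
  "('a, 'e::euclidean_space) chart set \<Rightarrow> ('a, 'e) chart \<Rightarrow> 'a \<Rightarrow> 'e \<Rightarrow> ('a, 'e) tvec"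
  where "coord_vector A c p v = (\<lambda>d. if d \<in> A \<and> p \<in> fst d
    then frechet_derivative (snd d \<circ> chart_inv c) (at (snd c p)) v else 0)"

definition velocity ::
  "('a, 'e::euclidean_space) chart set \<Rightarrow> real set \<Rightarrow> (real \<Rightarrow> 'a) \<Rightarrow> real \<Rightarrow> ('a, 'e) tvec"
  where "velocity A I \<gamma> t = (\<lambda>c. if c \<in> A \<and> \<gamma> t \<in> fst c
    then vector_derivative (snd c \<circ> \<gamma>) (at t within I) else 0)"

text \<open>The derivative of F, with values in a vector space, at p in the direction X; for smooth F it
  does not depend on the chart.\<close>

definition dir_deriv ::
  "('a, 'e::euclidean_space) chart set \<Rightarrow> 'a \<Rightarrow> ('a, 'e) tvec \<Rightarrow> ('a \<Rightarrow> 'f::real_normed_vector) \<Rightarrow> 'f"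
  where "dir_deriv A p X F = (let c = chart_at A p in
    frechet_derivative (F \<circ> chart_inv c) (at (snd c p)) (X c))"

definition differential ::
  "('a, 'e::euclidean_space) chart set \<Rightarrow> ('b, 'f::euclidean_space) chart set \<Rightarrow>
   ('a \<Rightarrow> 'b) \<Rightarrow> 'a \<Rightarrow> ('a, 'e) tvec \<Rightarrow> ('b, 'f) tvec"
  where "differential A B F p X = (\<lambda>d. if d \<in> B \<and> F p \<in> fst d
    then dir_deriv A p X (snd d \<circ> F) else 0)"

definition vector_fields :: "('a, 'e::euclidean_space) chart set \<Rightarrow> ('a \<Rightarrow> ('a, 'e) tvec) set"
  where "vector_fields A = {X. (\<forall>p\<in>points A. X p \<in> tangent_space A p) \<and>
    (\<forall>c\<in>A. smooth_on (snd c ` fst c) (\<lambda>y. X (chart_inv c y) c))}"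

definition lie_bracket ::
  "('a, 'e::euclidean_space) chart set \<Rightarrow> ('a \<Rightarrow> ('a, 'e) tvec) \<Rightarrow> ('a \<Rightarrow> ('a, 'e) tvec) \<Rightarrow>
   'a \<Rightarrow> ('a, 'e) tvec"
  where "lie_bracket A X Y p = (\<lambda>c. if c \<in> A \<and> p \<in> fst c
    then dir_deriv A p (X p) (\<lambda>q. Y q c) - dir_deriv A p (Y p) (\<lambda>q. X q c) else 0)"

subsection \<open>Pseudo-Riemannian metrics and the Levi-Civita connection\<close>

definition sym_bilinear_on :: "'v::real_vector set \<Rightarrow> ('v \<Rightarrow> 'v \<Rightarrow> real) \<Rightarrow> bool"
  where "sym_bilinear_on S B \<longleftrightarrow>
    (\<forall>X\<in>S. \<forall>Y\<in>S. B X Y = B Y X) \<and>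
    (\<forall>X\<in>S. \<forall>Y\<in>S. \<forall>Z\<in>S. \<forall>r. B (r *\<^sub>R X + Y) Z = r * B X Z + B Y Z)"

definition pseudo_riemannian_metric ::
  "('a, 'e::euclidean_space) chart set \<Rightarrow> ('a \<Rightarrow> ('a, 'e) tvec \<Rightarrow> ('a, 'e) tvec \<Rightarrow> real) \<Rightarrow> bool"
  where "pseudo_riemannian_metric A g \<longleftrightarrow>
    (\<forall>p\<in>points A. sym_bilinear_on (tangent_space A p) (g p) \<and>
       (\<forall>X\<in>tangent_space A p. (\<forall>Y\<in>tangent_space A p. g p X Y = 0) \<longrightarrow> X = 0)) \<and>
    (\<forall>c\<in>A. \<forall>v w. smooth_on (snd c ` fst c)
       (\<lambda>y. g (chart_inv c y) (coord_vector A c (chart_inv c y) v)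
                              (coord_vector A c (chart_inv c y) w)))"

type_synonym ('a, 'e) connection =
  "('a \<Rightarrow> ('a, 'e) tvec) \<Rightarrow> ('a \<Rightarrow> ('a, 'e) tvec) \<Rightarrow> 'a \<Rightarrow> ('a, 'e) tvec"

definition affine_connection :: "('a, 'e::euclidean_space) chart set \<Rightarrow> ('a, 'e) connection \<Rightarrow> bool"
  where "affine_connection A nab \<longleftrightarrow>
    (\<forall>X\<in>vector_fields A. \<forall>Y\<in>vector_fields A. nab X Y \<in> vector_fields A) \<and>
    (\<forall>X\<in>vector_fields A. \<forall>Y\<in>vector_fields A. \<forall>Z\<in>vector_fields A.
     \<forall>f\<in>smooth_functions A. \<forall>p\<in>points A.
       nab (X + Y) Z p = nab X Z p + nab Y Z p \<and>
       nab (\<lambda>q. f q *\<^sub>R X q) Z p = f p *\<^sub>R nab X Z p \<and>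
       nab X (Y + Z) p = nab X Y p + nab X Z p \<and>
       nab X (\<lambda>q. f q *\<^sub>R Y q) p = dir_deriv A p (X p) f *\<^sub>R Y p + f p *\<^sub>R nab X Y p)"

definition levi_civita_connection ::
  "('a, 'e::euclidean_space) chart set \<Rightarrow> ('a \<Rightarrow> ('a, 'e) tvec \<Rightarrow> ('a, 'e) tvec \<Rightarrow> real) \<Rightarrow>
   ('a, 'e) connection \<Rightarrow> bool"
  where "levi_civita_connection A g nab \<longleftrightarrow> affine_connection A nab \<and>
    (\<forall>X\<in>vector_fields A. \<forall>Y\<in>vector_fields A. \<forall>p\<in>points A.
       nab X Y p - nab Y X p = lie_bracket A X Y p) \<and>
    (\<forall>X\<in>vector_fields A. \<forall>Y\<in>vector_fields A. \<forall>Z\<in>vector_fields A. \<forall>p\<in>points A.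
       dir_deriv A p (X p) (\<lambda>q. g q (Y q) (Z q)) = g p (nab X Y p) (Z p) + g p (Y p) (nab X Z p))"

subsection \<open>The tangent bundle and its lifts\<close>

type_synonym ('a, 'e) tm = "'a \<times> ('a, 'e) tvec"

definition bundle_chart ::
  "('a, 'e::euclidean_space) chart set \<Rightarrow> ('a, 'e) chart \<Rightarrow> (('a, 'e) tm, 'e \<times> 'e) chart"
  where "bundle_chart A c =
    ({(p, X). p \<in> fst c \<and> X \<in> tangent_space A p}, \<lambda>(p, X). (snd c p, X c))"

definition bundle_atlas ::
  "('a, 'e::euclidean_space) chart set \<Rightarrow> (('a, 'e) tm, 'e \<times> 'e) chart set"
  where "bundle_atlas A = bundle_chart A ` A"

type_synonym ('a, 'e) ttm = "(('a, 'e) tm, 'e \<times> 'e) tvec"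

definition vertical_lift ::
  "('a, 'e::euclidean_space) chart set \<Rightarrow> 'a \<Rightarrow> ('a, 'e) tvec \<Rightarrow> ('a, 'e) tvec \<Rightarrow> ('a, 'e) ttm"
  where "vertical_lift A x u X = velocity (bundle_atlas A) UNIV (\<lambda>s. (x, u + s *\<^sub>R X)) 0"

text \<open>The horizontal lift is determined by V_*(X) = X^h + (nabla_X V)^v for every vector field V
  with V(x) = u. As the connection acts on vector fields, X is extended to a field W; the value of
  the covariant derivative at x does not depend on the extension.\<close>

definition horizontal_lift ::
  "('a, 'e::euclidean_space) chart set \<Rightarrow> ('a, 'e) connection \<Rightarrow>
   'a \<Rightarrow> ('a, 'e) tvec \<Rightarrow> ('a, 'e) tvec \<Rightarrow> ('a, 'e) ttm"
  where "horizontal_lift A nab x u X =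
    (THE \<xi>. \<forall>V\<in>vector_fields A. \<forall>W\<in>vector_fields A. V x = u \<and> W x = X \<longrightarrow>
       differential A (bundle_atlas A) (\<lambda>p. (p, V p)) x X = \<xi> + vertical_lift A x u (nab W V x))"

subsection \<open>The unit tangent bundle\<close>

definition unit_tangent_bundle ::
  "('a, 'e::euclidean_space) chart set \<Rightarrow> ('a \<Rightarrow> ('a, 'e) tvec \<Rightarrow> ('a, 'e) tvec \<Rightarrow> real) \<Rightarrow>
   ('a, 'e) tm set"
  where "unit_tangent_bundle A g =
    {(x, u). x \<in> points A \<and> u \<in> tangent_space A x \<and> g x u u = 1}"

definition tangential_lift ::
  "('a, 'e::euclidean_space) chart set \<Rightarrow> ('a \<Rightarrow> ('a, 'e) tvec \<Rightarrow> ('a, 'e) tvec \<Rightarrow> real) \<Rightarrow>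
   'a \<Rightarrow> ('a, 'e) tvec \<Rightarrow> ('a, 'e) tvec \<Rightarrow> ('a, 'e) ttm"
  where "tangential_lift A g x u X = vertical_lift A x u X - g x X u *\<^sub>R vertical_lift A x u u"

definition unit_bundle_tangent_space ::
  "('a, 'e::euclidean_space) chart set \<Rightarrow> ('a \<Rightarrow> ('a, 'e) tvec \<Rightarrow> ('a, 'e) tvec \<Rightarrow> real) \<Rightarrow>
   ('a, 'e) connection \<Rightarrow> 'a \<Rightarrow> ('a, 'e) tvec \<Rightarrow> ('a, 'e) ttm set"
  where "unit_bundle_tangent_space A g nab x u =
    {horizontal_lift A nab x u X + tangential_lift A g x u Y | X Y.
       X \<in> tangent_space A x \<and> Y \<in> tangent_space A x}"

definition kaluza_klein_metric ::
  "('a, 'e::euclidean_space) chart set \<Rightarrow> ('a \<Rightarrow> ('a, 'e) tvec \<Rightarrow> ('a, 'e) tvec \<Rightarrow> real) \<Rightarrow>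
   ('a, 'e) connection \<Rightarrow> real \<Rightarrow> real \<Rightarrow> real \<Rightarrow>
   (('a, 'e) tm \<Rightarrow> ('a, 'e) ttm \<Rightarrow> ('a, 'e) ttm \<Rightarrow> real) \<Rightarrow> bool"
  where "kaluza_klein_metric A g nab a c d G \<longleftrightarrow>
    a * (a + c) \<noteq> 0 \<and> a + c + d \<noteq> 0 \<and>
    (\<forall>(x, u)\<in>unit_tangent_bundle A g.
       sym_bilinear_on (unit_bundle_tangent_space A g nab x u) (G (x, u)) \<and>
       (\<forall>X\<in>tangent_space A x. \<forall>Y\<in>tangent_space A x.
          G (x, u) (horizontal_lift A nab x u X) (horizontal_lift A nab x u Y) =
            (a + c) * g x X Y + d * g x X u * g x Y u \<and>
          G (x, u) (horizontal_lift A nab x u X) (tangential_lift A g x u Y) = 0 \<and>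
          G (x, u) (tangential_lift A g x u Y) (horizontal_lift A nab x u X) = 0 \<and>
          G (x, u) (tangential_lift A g x u X) (tangential_lift A g x u Y) =
            a * g x X Y - a * g x X u * g x Y u))"

definition geodesic_field ::
  "('a, 'e::euclidean_space) chart set \<Rightarrow> ('a, 'e) connection \<Rightarrow> ('a, 'e) tm \<Rightarrow> ('a, 'e) ttm"
  where "geodesic_field A nab = (\<lambda>(x, u). horizontal_lift A nab x u u)"

subsection \<open>Curves in the unit tangent bundle\<close>

text \<open>The unit tangent bundle is an embedded submanifold of the tangent bundle, so a curve in it is
  smooth iff it is smooth as a curve in the tangent bundle.\<close>

definition unit_bundle_curve ::
  "('a, 'e::euclidean_space) chart set \<Rightarrow> ('a \<Rightarrow> ('a, 'e) tvec \<Rightarrow> ('a, 'e) tvec \<Rightarrow> real) \<Rightarrow>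
   real set \<Rightarrow> (real \<Rightarrow> ('a, 'e) tm) \<Rightarrow> bool"
  where "unit_bundle_curve A g I \<gamma> \<longleftrightarrow>
    smooth_curve (bundle_atlas A) I \<gamma> \<and> \<gamma> ` I \<subseteq> unit_tangent_bundle A g"

definition vertical_curve :: "real set \<Rightarrow> (real \<Rightarrow> ('a, 'e) tm) \<Rightarrow> bool"
  where "vertical_curve I \<gamma> \<longleftrightarrow> (\<exists>x. \<forall>t\<in>I. fst (\<gamma> t) = x)"

definition arc_length_parameterized ::
  "('a, 'e::euclidean_space) chart set \<Rightarrow> (('a, 'e) tm \<Rightarrow> ('a, 'e) ttm \<Rightarrow> ('a, 'e) ttm \<Rightarrow> real) \<Rightarrow>
   real set \<Rightarrow> (real \<Rightarrow> ('a, 'e) tm) \<Rightarrow> bool"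
  where "arc_length_parameterized A G I \<gamma> \<longleftrightarrow>
    (\<forall>t\<in>I. \<bar>G (\<gamma> t) (velocity (bundle_atlas A) I \<gamma> t) (velocity (bundle_atlas A) I \<gamma> t)\<bar> = 1)"

definition helix_curve ::
  "('a, 'e::euclidean_space) chart set \<Rightarrow> ('a \<Rightarrow> ('a, 'e) tvec \<Rightarrow> ('a, 'e) tvec \<Rightarrow> real) \<Rightarrow>
   (('a, 'e) tm \<Rightarrow> ('a, 'e) ttm \<Rightarrow> ('a, 'e) ttm \<Rightarrow> real) \<Rightarrow> (('a, 'e) tm \<Rightarrow> ('a, 'e) ttm) \<Rightarrow>
   real set \<Rightarrow> (real \<Rightarrow> ('a, 'e) tm) \<Rightarrow> bool"
  where "helix_curve A g G \<xi> I \<gamma> \<longleftrightarrow>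
    unit_bundle_curve A g I \<gamma> \<and> arc_length_parameterized A G I \<gamma> \<and>
    (\<exists>k. \<forall>t\<in>I. G (\<gamma> t) (velocity (bundle_atlas A) I \<gamma> t) (\<xi> (\<gamma> t)) = k)"

end

theory Submission
  imports Defs
begin

text \<open>The velocity of a vertical curve \<open>(x, V)\<close> is the vertical lift of \<open>V'\<close>. Differentiating
  \<open>g(V, V) = 1\<close> in the fixed tangent space at \<open>x\<close> gives \<open>g(V', V) = 0\<close>, so it is also the tangential
  lift of \<open>V'\<close>, which is orthogonal to all horizontal lifts, in particular to the geodesic field.\<close>

section \<open>Tangent spaces as vector spaces seen through charts\<close>

lemma transition_bounded_linear:
  assumes man: "smooth_manifold T A" and c: "c \<in> A" "p \<in> fst c" and d: "d \<in> A" "p \<in> fst d"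
  shows "bounded_linear (frechet_derivative (snd d \<circ> chart_inv c) (at (snd c p)))"
proof -
  let ?S = "snd c ` (fst c \<inter> fst d)"
  have open_c: "openin T (fst c)" and open_d: "openin T (fst d)"
    and open_im: "open (snd c ` fst c)"
    and hom: "homeomorphic_map (subtopology T (fst c)) (top_of_set (snd c ` fst c)) (snd c)"
    and sm: "smooth_on ?S (snd d \<circ> chart_inv c)"
    using man c d unfolding smooth_manifold_def by blast+
  \<comment> \<open>Smoothness of the coordinate change is differentiability within the overlap
    image, whereas \<open>tangent_space\<close> uses the derivative at the point itself. The two
    match because the chart, a homeomorphism, carries the open overlap to an open set.\<close>
  have "openin (subtopology T (fst c)) (fst c \<inter> fst d)"
    using open_d by (simp add: openin_subtopology_Int2)
  then have "openin (top_of_set (snd c ` fst c)) ?S"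
    using homeomorphic_imp_open_map[OF hom] unfolding open_map_def by blast
  then have "open ?S"
    using open_im openin_open_trans by blast
  moreover have "(snd d \<circ> chart_inv c) differentiable_on ?S"
    using sm unfolding smooth_on_def by (metis Ck_on.simps(2))
  moreover have "snd c p \<in> ?S"
    using c d by blast
  ultimately have "(snd d \<circ> chart_inv c) differentiable (at (snd c p))"
    using differentiable_on_eq_differentiable_at by blast
  then show ?thesis
    using frechet_derivative_works has_derivative_bounded_linear by blast
qed

lemma tangent_spaceI:
  assumes "\<And>c d. \<lbrakk>c \<in> A; d \<in> A; p \<in> fst c; p \<in> fst d\<rbrakk> \<Longrightarrow>
      X d = frechet_derivative (snd d \<circ> chart_inv c) (at (snd c p)) (X c)"
    and "\<And>c. \<not> (c \<in> A \<and> p \<in> fst c) \<Longrightarrow> X c = 0"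
  shows "X \<in> tangent_space A p"
  using assms unfolding tangent_space_def by blast

lemma tangent_space_transition:
  assumes "X \<in> tangent_space A p" "c \<in> A" "d \<in> A" "p \<in> fst c" "p \<in> fst d"
  shows "X d = frechet_derivative (snd d \<circ> chart_inv c) (at (snd c p)) (X c)"
  using assms unfolding tangent_space_def by blast

lemma tangent_space_outside:
  assumes "X \<in> tangent_space A p" "\<not> (c \<in> A \<and> p \<in> fst c)"
  shows "X c = 0"
  using assms unfolding tangent_space_def by blast

text \<open>Linearity of the transition derivatives makes the compatibility condition survive the
  pointwise operations. This is what later allows a linear left inverse of evaluation in a
  chart.\<close>

lemma subspace_tangent_space:
  assumes man: "smooth_manifold T A"
  shows "subspace (tangent_space A p)"
proof (rule subspaceI)
  have lin: "linear (frechet_derivative (snd d \<circ> chart_inv c) (at (snd c p)))"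
    if "c \<in> A" "d \<in> A" "p \<in> fst c" "p \<in> fst d" for c d
    using transition_bounded_linear[OF man that(1,3,2,4)] bounded_linear.linear by blast
  show "0 \<in> tangent_space A p"
    by (rule tangent_spaceI) (simp_all add: linear_0 lin)
  show "X + Y \<in> tangent_space A p" if "X \<in> tangent_space A p" "Y \<in> tangent_space A p" for X Y
  proof (rule tangent_spaceI)
    fix c d assume cd: "c \<in> A" "d \<in> A" "p \<in> fst c" "p \<in> fst d"
    show "(X + Y) d = frechet_derivative (snd d \<circ> chart_inv c) (at (snd c p)) ((X + Y) c)"
      unfolding plus_fun_apply linear_add[OF lin[OF cd]]
      using that[THEN tangent_space_transition, OF cd] by metis
  next
    show "(X + Y) c = 0" if "\<not> (c \<in> A \<and> p \<in> fst c)" for c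
      using tangent_space_outside[OF \<open>X \<in> _\<close> that] tangent_space_outside[OF \<open>Y \<in> _\<close> that]
      by simp
  qed
  show "r *\<^sub>R X \<in> tangent_space A p" if "X \<in> tangent_space A p" for r X
  proof (rule tangent_spaceI)
    fix c d assume cd: "c \<in> A" "d \<in> A" "p \<in> fst c" "p \<in> fst d"
    show "(r *\<^sub>R X) d = frechet_derivative (snd d \<circ> chart_inv c) (at (snd c p)) ((r *\<^sub>R X) c)"
      unfolding scaleR_fun_def linear_cmul[OF lin[OF cd]]
      using tangent_space_transition[OF that cd] by metis
  next
    show "(r *\<^sub>R X) c = 0" if "\<not> (c \<in> A \<and> p \<in> fst c)" for c
      using tangent_space_outside[OF \<open>X \<in> _\<close> that] by (simp add: scaleR_fun_def)
  qed
qed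

lemma tangent_vector_eqI:
  assumes X: "X \<in> tangent_space A p" and Y: "Y \<in> tangent_space A p"
    and c: "c \<in> A" "p \<in> fst c" and eq: "X c = Y c"
  shows "X = Y"
proof
  fix d
  show "X d = Y d"
  proof (cases "d \<in> A \<and> p \<in> fst d")
    case True
    then have d: "d \<in> A" "p \<in> fst d"
      by blast+
    show ?thesis
      using tangent_space_transition[OF X c(1) d(1) c(2) d(2)]
        tangent_space_transition[OF Y c(1) d(1) c(2) d(2)] eq by metis
  next
    case False
    show ?thesis
      using tangent_space_outside[OF X False] tangent_space_outside[OF Y False] by metis
  qed
qed

section \<open>Differentiating curves on an interval\<close>

text \<open>A connected set with more than one point has no isolated points. Hence derivatives
  within \<open>I\<close> are unique, even at an endpoint belonging to \<open>I\<close>.\<close>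

lemma islimpt_nondegenerate_interval:
  fixes I :: "real set"
  assumes "is_interval I" "interior I \<noteq> {}" "t \<in> I"
  shows "t islimpt I"
proof -
  have "I \<noteq> {t}"
    using assms(2) by auto
  then show ?thesis
    using connected_imp_perfect assms is_interval_connected_1 by blast
qed

lemma smooth_curve_differentiable:
  assumes "smooth_curve A I \<gamma>" "t \<in> I"
  obtains c where "c \<in> A" "\<gamma> t \<in> fst c" "(snd c \<circ> \<gamma>) differentiable (at t within I)"
proof -
  obtain c J where c: "c \<in> A" and J: "open J" "t \<in> J" "\<gamma> ` (I \<inter> J) \<subseteq> fst c"
    and sm: "smooth_on (I \<inter> J) (snd c \<circ> \<gamma>)"
    using assms unfolding smooth_curve_def by blast
  have "(snd c \<circ> \<gamma>) differentiable_on (I \<inter> J)"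
    using sm unfolding smooth_on_def by (metis Ck_on.simps(2))
  then have "(snd c \<circ> \<gamma>) differentiable (at t within (I \<inter> J))"
    using assms(2) J(2) unfolding differentiable_on_def by blast
  moreover have "at t within (I \<inter> J) = at t within I"
    using J by (intro at_within_nhd[where S = J]) auto
  ultimately show thesis
    using that c J assms(2) by (metis IntI image_subset_iff)
qed

text \<open>The line through \<open>u\<close> in direction \<open>X\<close> keeps the base
  coordinates fixed and is affine in the fibre coordinates. Tangency of \<open>u\<close> puts
  \<open>(x, u)\<close> into the chart domain, off which \<open>velocity\<close> is 0 by
  convention.\<close>

lemma vertical_lift_bundle_chart:
  assumes "c \<in> A" "x \<in> fst c" "u \<in> tangent_space A x"
  shows "vertical_lift A x u X (bundle_chart A c) = (0, X c)"
proof -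
  have "((\<lambda>s. (snd c x, u c + s *\<^sub>R X c)) has_vector_derivative (0, X c)) (at 0)"
    by (auto intro!: derivative_eq_intros has_vector_derivative_Pair)
  moreover have "snd (bundle_chart A c) \<circ> (\<lambda>s. (x, u + s *\<^sub>R X)) =
      (\<lambda>s. (snd c x, u c + s *\<^sub>R X c))"
    by (auto simp: bundle_chart_def scaleR_fun_def)
  ultimately show ?thesis
    using assms unfolding vertical_lift_def velocity_def
    by (auto simp: bundle_atlas_def bundle_chart_def vector_derivative_at)
qed

lemma vertical_lift_outside:
  assumes "\<not> (b \<in> bundle_atlas A \<and> (x, u) \<in> fst b)"
  shows "vertical_lift A x u X b = 0"
  using assms unfolding vertical_lift_def velocity_def by auto

section \<open>Vector fields along a constant curve\<close>

text \<open>With the base point fixed, a change of chart acts on components by one constant linear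
  map. So differentiability in a single chart spreads to all charts around \<open>x\<close>, and the
  derivatives transform like a tangent vector.\<close>

lemma derivative_in_tangent_space:
  fixes V :: "real \<Rightarrow> ('a, 'e::euclidean_space) tvec"
  assumes man: "smooth_manifold T A" and t: "t \<in> I" and lim: "t islimpt I"
    and V: "\<And>s. s \<in> I \<Longrightarrow> V s \<in> tangent_space A x"
    and c0: "c0 \<in> A" "x \<in> fst c0"
    and diff: "((\<lambda>s. V s c0) has_vector_derivative v) (at t within I)"
  shows "\<exists>Y\<in>tangent_space A x. \<forall>c\<in>A. x \<in> fst c \<longrightarrow>
    ((\<lambda>s. V s c) has_vector_derivative Y c) (at t within I)"
proof -
  let ?D = "\<lambda>c d. frechet_derivative (snd d \<circ> chart_inv c) (at (snd c x))"
  have nb: "at t within I \<noteq> bot"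
    using lim trivial_limit_within by blast
  have push: "((\<lambda>s. V s d) has_vector_derivative ?D c d w) (at t within I)"
    if c: "c \<in> A" "x \<in> fst c" and d: "d \<in> A" "x \<in> fst d"
      and w: "((\<lambda>s. V s c) has_vector_derivative w) (at t within I)" for c d w
  proof (rule has_vector_derivative_transform[OF t])
    show "((\<lambda>s. ?D c d (V s c)) has_vector_derivative ?D c d w) (at t within I)"
      using bounded_linear.has_vector_derivative[OF transition_bounded_linear[OF man c d] w] .
    show "V s d = ?D c d (V s c)" if "s \<in> I" for s
      using tangent_space_transition[OF V[OF that] c(1) d(1) c(2) d(2)] .
  qed
  \<comment> \<open>The derivative \<open>v\<close> is carried from \<open>c0\<close> to every chart
    around \<open>x\<close>; the value 0 elsewhere is the one \<open>tangent_space\<close>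
    prescribes.\<close>
  define Y where "Y = (\<lambda>c. if c \<in> A \<and> x \<in> fst c then ?D c0 c v else 0)"
  have Y: "((\<lambda>s. V s c) has_vector_derivative Y c) (at t within I)"
    if "c \<in> A" "x \<in> fst c" for c
    using push[OF c0 that diff] that by (simp add: Y_def)
  \<comment> \<open>Both sides are derivatives of the component in \<open>d\<close>, so uniqueness
    stands in for the cocycle identity of the transition derivatives.\<close>
  have transition: "Y d = ?D c d (Y c)" if "c \<in> A" "x \<in> fst c" "d \<in> A" "x \<in> fst d" for c d
    using vector_derivative_unique_within[OF nb Y[OF that(3,4)] push[OF that Y[OF that(1,2)]]] .
  have "Y \<in> tangent_space A x"
  proof (rule tangent_spaceI)
    show "Y d = ?D c d (Y c)" if "c \<in> A" "d \<in> A" "x \<in> fst c" "x \<in> fst d" for c d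
      using transition[OF that(1,3,2,4)] .
    show "Y c = 0" if "\<not> (c \<in> A \<and> x \<in> fst c)" for c
      using that unfolding Y_def by (rule if_not_P)
  qed
  with Y show ?thesis
    by (intro bexI[where x = Y]) blast+
qed

text \<open>This is the product rule for \<open>B (V s) (V s) = 1\<close>. As \<open>B\<close> acts
  on families of components, the form is first moved to the Euclidean space \<open>'e\<close>, where
  bilinear maps are bounded and the rule applies.\<close>

lemma unit_field_orthogonal_derivative:
  fixes V :: "real \<Rightarrow> ('a, 'e::euclidean_space) tvec"
  assumes man: "smooth_manifold T A" and t: "t \<in> I" and lim: "t islimpt I"
    and B: "sym_bilinear_on (tangent_space A x) B"
    and V: "\<And>s. s \<in> I \<Longrightarrow> V s \<in> tangent_space A x"
    and unit: "\<And>s. s \<in> I \<Longrightarrow> B (V s) (V s) = 1"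
    and c: "c \<in> A" "x \<in> fst c"
    and Y: "Y \<in> tangent_space A x"
    and diff: "((\<lambda>s. V s c) has_vector_derivative Y c) (at t within I)"
  shows "B Y (V t) = 0"
proof -
  \<comment> \<open>A tangent vector is determined by its component in \<open>c\<close>; the left
    inverse \<open>h\<close> of this evaluation rebuilds the vector from that component.\<close>
  have "linear (\<lambda>X::('a, 'e) tvec. X c)"
    by (simp add: linear_iff scaleR_fun_def)
  moreover have "inj_on (\<lambda>X. X c) (tangent_space A x)"
    by (rule inj_onI) (rule tangent_vector_eqI[OF _ _ c])
  ultimately obtain h :: "'e \<Rightarrow> ('a, 'e) tvec" where h: "range h \<subseteq> tangent_space A x" "linear h"
      and hc: "\<And>X. X \<in> tangent_space A x \<Longrightarrow> h (X c) = X"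
    using linear_exists_left_inverse_on[OF _ subspace_tangent_space[OF man, of x],
        of "\<lambda>X. X c"] by auto
  have mem: "h v \<in> tangent_space A x" for v
    using h by blast
  have sym: "B (h v) (h w) = B (h w) (h v)" for v w
    using B mem unfolding sym_bilinear_on_def by blast
  have comb: "B (h (r *\<^sub>R v + v')) (h w) = r * B (h v) (h w) + B (h v') (h w)" for r v v' w
    using B mem linear_add[OF h(2)] linear_cmul[OF h(2)] unfolding sym_bilinear_on_def by metis
  \<comment> \<open>All zero vectors and \<open>r = 1\<close> in \<open>comb\<close> give
    \<open>b = b + b\<close>. Then \<open>r = 1\<close> in \<open>comb\<close> yields additivity,
    and \<open>v' = 0\<close> together with \<open>zero\<close> yields homogeneity.\<close>
  have zero: "B (h 0) (h w) = 0" for w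
    using comb[of 1 0 0 w] by simp
  have lin: "linear (\<lambda>v. B (h v) (h w))" for w
    using comb[of 1 _ _ w] comb[of _ _ 0 w] zero by (intro linearI) simp_all
  have "linear (\<lambda>w. B (h v) (h w))" for v
    using lin[of v] by (subst sym)
  then have "bilinear (\<lambda>v w. B (h v) (h w))"
    unfolding bilinear_def using lin by blast
  then have "bounded_bilinear (\<lambda>v w. B (h v) (h w))"
    by (simp add: bilinear_conv_bounded_bilinear)
  from bounded_bilinear.has_vector_derivative[OF this diff diff]
  have "((\<lambda>s. B (h (V s c)) (h (V s c))) has_vector_derivative
      (B (h (V t c)) (h (Y c)) + B (h (Y c)) (h (V t c)))) (at t within I)" .
  \<comment> \<open>On \<open>I\<close> the map \<open>h\<close> returns \<open>V s\<close> itself,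
    so the function is constantly 1 there.\<close>
  moreover have "((\<lambda>s. B (h (V s c)) (h (V s c))) has_vector_derivative 0) (at t within I)"
    by (rule has_vector_derivative_transform[OF t _ has_vector_derivative_const[of 1]])
      (simp add: hc V unit)
  ultimately have "B (h (V t c)) (h (Y c)) + B (h (Y c)) (h (V t c)) = 0"
    using vector_derivative_unique_within lim trivial_limit_within by blast
  then have "B (h (Y c)) (h (V t c)) = 0"
    using sym[of "V t c" "Y c"] by simp
  then show ?thesis
    by (simp add: hc V[OF t] Y)
qed

section \<open>The velocity of a vertical curve\<close>

lemma vertical_curve_velocity_tangential:
  fixes A :: "('a, 'e::euclidean_space) chart set"
  assumes man: "smooth_manifold T A" and met: "pseudo_riemannian_metric A g"
    and curve: "unit_bundle_curve A g I \<gamma>" and x: "\<And>s. s \<in> I \<Longrightarrow> fst (\<gamma> s) = x" and t: "t \<in> I"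
  obtains Y where "Y \<in> tangent_space A x"
    "velocity (bundle_atlas A) I \<gamma> t = tangential_lift A g x (snd (\<gamma> t)) Y"
proof -
  let ?V = "\<lambda>s. snd (\<gamma> s)"
  have sm: "smooth_curve (bundle_atlas A) I \<gamma>" and im: "\<gamma> ` I \<subseteq> unit_tangent_bundle A g"
    using curve unfolding unit_bundle_curve_def by auto
  have \<gamma>: "\<gamma> s = (x, ?V s)" if "s \<in> I" for s
    by (rule prod_eqI) (simp_all add: x that)
  have "(x, ?V s) \<in> unit_tangent_bundle A g" if "s \<in> I" for s
    using subsetD[OF im imageI[OF that]] by (subst \<gamma>[OF that, symmetric])
  then have V: "?V s \<in> tangent_space A x" "g x (?V s) (?V s) = 1" "x \<in> points A" if "s \<in> I" for s
    using that unfolding unit_tangent_bundle_def by blast+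
  have lim: "t islimpt I"
    using islimpt_nondegenerate_interval t sm unfolding smooth_curve_def by blast
  then have nb: "at t within I \<noteq> bot"
    using trivial_limit_within by blast
  have snd_chart: "snd (bundle_chart A c) \<circ> \<gamma> = (\<lambda>s. (snd c (fst (\<gamma> s)), ?V s c))" for c
    by (auto simp: bundle_chart_def split: prod.splits)
  \<comment> \<open>Smoothness supplies one bundle chart around the point of the curve; the fibre
    half of the coordinate curve is the component of \<open>V\<close> in \<open>c\<close>, which
    seeds \<open>derivative_in_tangent_space\<close>.\<close>
  obtain c where c: "c \<in> A" "\<gamma> t \<in> fst (bundle_chart A c)"
    and diff: "(snd (bundle_chart A c) \<circ> \<gamma>) differentiable (at t within I)"
    using smooth_curve_differentiable[OF sm t] unfolding bundle_atlas_def by blast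
  have xc: "x \<in> fst c"
    using c(2) x[OF t] by (auto simp: bundle_chart_def)
  have "(\<lambda>s. (snd c (fst (\<gamma> s)), ?V s c)) differentiable (at t within I)"
    by (rule back_subst[where P = "\<lambda>f. f differentiable (at t within I)", OF diff snd_chart])
  note bounded_linear.has_vector_derivative[OF bounded_linear_snd
      vector_derivative_works[THEN iffD1, OF this]]
  then have dVc: "((\<lambda>s. ?V s c) has_vector_derivative
      snd (vector_derivative (\<lambda>s. (snd c (fst (\<gamma> s)), ?V s c)) (at t within I))) (at t within I)"
    unfolding snd_conv .
  have "\<exists>Y\<in>tangent_space A x. \<forall>c\<in>A. x \<in> fst c \<longrightarrow>
      ((\<lambda>s. ?V s c) has_vector_derivative Y c) (at t within I)"
    by (rule derivative_in_tangent_space[where V = "?V", OF man t lim V(1) c(1) xc dVc])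
  then obtain Y where Y: "Y \<in> tangent_space A x" and all_dV: "\<forall>c\<in>A. x \<in> fst c \<longrightarrow>
      ((\<lambda>s. ?V s c) has_vector_derivative Y c) (at t within I)"
    by (rule bexE)
  have dV: "((\<lambda>s. ?V s c) has_vector_derivative Y c) (at t within I)"
    if "c \<in> A" "x \<in> fst c" for c
    using all_dV[rule_format, OF that] .
  have "sym_bilinear_on (tangent_space A x) (g x)"
    using met V(3)[OF t] unfolding pseudo_riemannian_metric_def by blast
  then have orth: "g x Y (?V t) = 0"
    by (rule unit_field_orthogonal_derivative[where V = "?V" and B = "g x",
        OF man t lim _ V(1) V(2) c(1) xc Y dV[OF c(1) xc]])
  \<comment> \<open>Vectors tangent to the bundle are families over bundle charts, so the equality
    is checked chart by chart. Around the point both components are \<open>(0, Y d)\<close>, the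
    base part being constant; elsewhere both are 0 by default.\<close>
  have "velocity (bundle_atlas A) I \<gamma> t = vertical_lift A x (?V t) Y"
  proof
    fix b
    show "velocity (bundle_atlas A) I \<gamma> t b = vertical_lift A x (?V t) Y b"
    proof (cases "b \<in> bundle_atlas A \<and> \<gamma> t \<in> fst b")
      case True
      then obtain d where d: "d \<in> A" and b: "b = bundle_chart A d"
        unfolding bundle_atlas_def by blast
      have xd: "x \<in> fst d"
        using True b x[OF t] by (auto simp: bundle_chart_def)
      have "((\<lambda>s. (snd d x, ?V s d)) has_vector_derivative (0, Y d)) (at t within I)"
        using dV[OF d xd] by (intro has_vector_derivative_Pair) auto
      then have "((snd b \<circ> \<gamma>) has_vector_derivative (0, Y d)) (at t within I)"
        unfolding b snd_chart
        by (rule has_vector_derivative_transform[OF t, rotated]) (simp add: x)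
      then have "vector_derivative (snd b \<circ> \<gamma>) (at t within I) = (0, Y d)"
        using vector_derivative_within[OF nb] by blast
      then show ?thesis
        using True vertical_lift_bundle_chart[OF d xd V(1)[OF t]] b by (simp add: velocity_def)
    next
      case False
      then have "vertical_lift A x (?V t) Y b = 0"
        by (intro vertical_lift_outside) (simp only: \<gamma>[OF t, symmetric] not_False_eq_True)
      with False show ?thesis
        by (simp only: velocity_def if_False)
    qed
  qed
  \<comment> \<open>Orthogonality makes the coefficient of the correction term
    \<open>vertical_lift A x u u\<close>, with \<open>u = snd (\<gamma> t)\<close>, vanish.\<close>
  then have "velocity (bundle_atlas A) I \<gamma> t = tangential_lift A g x (?V t) Y"
    unfolding tangential_lift_def orth scaleR_zero_left diff_zero .
  with Y show thesis
    by (rule that)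
qed

section \<open>Orthogonality to the geodesic field\<close>

lemma kaluza_klein_metric_tangential_horizontal:
  assumes "kaluza_klein_metric A g nab a c d G" and "(x, u) \<in> unit_tangent_bundle A g"
    and "Y \<in> tangent_space A x" "X \<in> tangent_space A x"
  shows "G (x, u) (tangential_lift A g x u Y) (horizontal_lift A nab x u X) = 0"
proof -
  note assms(1)[unfolded kaluza_klein_metric_def, THEN conjunct2, THEN conjunct2,
      THEN bspec, OF assms(2), unfolded prod.case, THEN conjunct2, THEN bspec, OF assms(4),
      THEN bspec, OF assms(3)]
  then show ?thesis
    by (elim conjE)
qed

theorem mainTheorem8:
  fixes T :: "'a topology"
    and A :: "('a, real^2) chart set"
    and g :: "'a \<Rightarrow> ('a, real^2) tvec \<Rightarrow> ('a, real^2) tvec \<Rightarrow> real"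
    and nab :: "('a, real^2) connection"
    and a c d :: real
    and G :: "('a, real^2) tm \<Rightarrow> ('a, real^2) ttm \<Rightarrow> ('a, real^2) ttm \<Rightarrow> real"
    and I :: "real set"
    and \<gamma> :: "real \<Rightarrow> ('a, real^2) tm"
  assumes "smooth_manifold T A"
    and "pseudo_riemannian_metric A g"
    and "levi_civita_connection A g nab"
    and "kaluza_klein_metric A g nab a c d G"
    and "unit_bundle_curve A g I \<gamma>"
    and "vertical_curve I \<gamma>"
    and "arc_length_parameterized A G I \<gamma>"
  shows "helix_curve A g G (geodesic_field A nab) I \<gamma>"
proof -
  obtain x where x: "\<And>t. t \<in> I \<Longrightarrow> fst (\<gamma> t) = x"
    using assms(6) unfolding vertical_curve_def by blast
  \<comment> \<open>The constant required of a helix is 0 here: the geodesic field at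
    \<open>(x, u)\<close> is the horizontal lift of the tangent vector \<open>u\<close>.\<close>
  have "G (\<gamma> t) (velocity (bundle_atlas A) I \<gamma> t) (geodesic_field A nab (\<gamma> t)) = 0"
    if t: "t \<in> I" for t
  proof -
    obtain Y where Y: "Y \<in> tangent_space A x"
      "velocity (bundle_atlas A) I \<gamma> t = tangential_lift A g x (snd (\<gamma> t)) Y"
      using vertical_curve_velocity_tangential[OF assms(1,2,5) x t] by blast
    define u where "u = snd (\<gamma> t)"
    have \<gamma>: "\<gamma> t = (x, u)"
      unfolding u_def by (rule prod_eqI) (simp_all add: x t)
    have "\<gamma> t \<in> unit_tangent_bundle A g"
      using assms(5) t unfolding unit_bundle_curve_def by blast
    then have u: "(x, u) \<in> unit_tangent_bundle A g"
      unfolding \<gamma> .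
    then have "u \<in> tangent_space A x"
      unfolding unit_tangent_bundle_def by blast
    then have "G (x, u) (tangential_lift A g x u Y) (horizontal_lift A nab x u u) = 0"
      using kaluza_klein_metric_tangential_horizontal[OF assms(4) u Y(1)] by blast
    then show ?thesis
      unfolding Y(2) \<gamma> geodesic_field_def snd_conv prod.case .
  qed
  then show ?thesis
    using assms(5,7) unfolding helix_curve_def by blast
qed

end
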